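(* Let $\mathbf M$ be a linearly ordered complete MV-algebra, let $(S,T,R)$ be a frame, and let $G^*:M^T\to M^S$ be defined by $$G^*(p)(s)=\bigwedge\{p(t)\mid t\in T,\ sRt\}$$ for all $p\in M^T$ and $s\in S$. Then $G^*:\mathbf M^T\to\mathbf M^S$ is a strong fm-function between MV-algebras which has a left adjoint $P^*:M^S\to M^T$ (i.e. $q\le G^*(p)$ iff $P^*(q)\le p$, for all $p\in M^T$, $q\in M^S$). In this case, for all $q\in M^S$ and $t\in T$, $$P^*(q)(t)=\bigvee\{q(s)\mid s\in S,\ sRt\},$$ and $P^*:(\mathbf M^S)^{op}\to(\mathbf M^T)^{op}$ is a strong fm-function between MV-algebras.
   Context: An MV-algebra $(A,\oplus,\neg,0)$ has $1=\neg 0$, $x\odot y=\neg(\neg x\oplus\neg y)$, order $x\le y$ iff $\neg x\oplus y=1$, and the induced lattice operations $\vee,\wedge$. It is linearly ordered (complete) if this order is linear (a complete lattice). For $n\ge1$, $n\times x=x\oplus\cdots\oplus x$ ($n$ times) and $x^n=x\odot\cdots\odot x$ ($n$ times). Powers $\mathbf M^T$ carry componentwise operations. For an MV-algebra $\mathbf A$, $\mathbf A^{op}$ is the dual MV-algebra on the same set, with $\oplus$ and $\odot$ interchanged, $0$ and $1$ interchanged, the same $\neg$, and hence the reversed order. A frame is a triple $(S,T,R)$ where $S,T$ are non-empty sets and $R\subseteq S\times T$. Empty infima are $1$ and empty suprema are $0$. A map $G:\mathbf A_1\to\mathbf A_2$ between MV-algebras is an fm-function if, for all $x,y$: (FM1)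 $G(1)=1$; (FM2) $x\le y$ implies $G(x)\le G(y)$; (FM3) $G(x)=1=G(y)$ implies $G(x\odot y)=1$; (FM4) $G(x)\odot G(x)=G(x\odot x)$; (FM5) $G(x)\oplus G(x)=G(x\oplus x)$. It is a strong fm-function if moreover, for all $x,y$ and all integers $n\ge1$: (FM6) $G(x)\odot G(y)\le G(x\odot y)$; (FM7) $G(x)\oplus G(y)\le G(x\oplus y)$; (FM8) $G(x)\wedge G(y)=G(x\wedge y)$; (FM9) $G(x^n)=G(x)^n$; (FM10) $n\times G(x)=G(n\times x)$. *)

theory Defs
  imports "HOL-Algebra.Galois_Connection"
begin

section \<open>MV-algebras\<close>

record 'a mv = "'a partial_object" +
  mv_plus :: "'a \<Rightarrow> 'a \<Rightarrow> 'a"  (infixl \<open>\<oplus>\<index>\<close> 65)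
  mv_neg :: "'a \<Rightarrow> 'a"  (\<open>\<sim>\<index> _\<close> [81] 80)
  mv_zero :: 'a  (\<open>\<zero>\<index>\<close>)

definition mv_one :: "('a, 'm) mv_scheme \<Rightarrow> 'a"  (\<open>\<one>\<index>\<close>)
  where "\<one>\<^bsub>A\<^esub> = \<sim>\<^bsub>A\<^esub> \<zero>\<^bsub>A\<^esub>"

definition mv_times :: "('a, 'm) mv_scheme \<Rightarrow> 'a \<Rightarrow> 'a \<Rightarrow> 'a"  (infixl \<open>\<odot>\<index>\<close> 70)
  where "x \<odot>\<^bsub>A\<^esub> y = \<sim>\<^bsub>A\<^esub> (\<sim>\<^bsub>A\<^esub> x \<oplus>\<^bsub>A\<^esub> \<sim>\<^bsub>A\<^esub> y)"

locale mv_algebra =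
  fixes A (structure)
  assumes plus_closed: "\<lbrakk>x \<in> carrier A; y \<in> carrier A\<rbrakk> \<Longrightarrow> x \<oplus> y \<in> carrier A"
    and neg_closed: "x \<in> carrier A \<Longrightarrow> \<sim> x \<in> carrier A"
    and zero_closed: "\<zero> \<in> carrier A"
    and plus_assoc: "\<lbrakk>x \<in> carrier A; y \<in> carrier A; z \<in> carrier A\<rbrakk>
      \<Longrightarrow> (x \<oplus> y) \<oplus> z = x \<oplus> (y \<oplus> z)"
    and plus_comm: "\<lbrakk>x \<in> carrier A; y \<in> carrier A\<rbrakk> \<Longrightarrow> x \<oplus> y = y \<oplus> x"
    and plus_zero: "x \<in> carrier A \<Longrightarrow> x \<oplus> \<zero> = x"
    and neg_neg: "x \<in> carrier A \<Longrightarrow> \<sim> (\<sim> x) = x"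
    and plus_one: "x \<in> carrier A \<Longrightarrow> x \<oplus> \<sim> \<zero> = \<sim> \<zero>"
    and lukasiewicz: "\<lbrakk>x \<in> carrier A; y \<in> carrier A\<rbrakk>
      \<Longrightarrow> \<sim> (\<sim> x \<oplus> y) \<oplus> y = \<sim> (\<sim> y \<oplus> x) \<oplus> x"

text \<open>The induced lattice operations and arbitrary infima and suprema of an MV-algebra are
  those of the following order, as provided by the theory of lattices.\<close>

definition mv_order :: "('a, 'm) mv_scheme \<Rightarrow> 'a gorder"
  where "mv_order A =
    \<lparr>carrier = carrier A, eq = (=), le = (\<lambda>x y. \<sim>\<^bsub>A\<^esub> x \<oplus>\<^bsub>A\<^esub> y = \<one>\<^bsub>A\<^esub>)\<rparr>"

text \<open>Only iterates with \<^term>\<open>n \<ge> (1::nat)\<close> are used; the values at 0 merely start the recursion.\<close>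

primrec mv_multiple :: "('a, 'm) mv_scheme \<Rightarrow> nat \<Rightarrow> 'a \<Rightarrow> 'a"
  where
    "mv_multiple A 0 x = \<zero>\<^bsub>A\<^esub>"
  | "mv_multiple A (Suc n) x = x \<oplus>\<^bsub>A\<^esub> mv_multiple A n x"

primrec mv_pow :: "('a, 'm) mv_scheme \<Rightarrow> 'a \<Rightarrow> nat \<Rightarrow> 'a"
  where
    "mv_pow A x 0 = \<one>\<^bsub>A\<^esub>"
  | "mv_pow A x (Suc n) = x \<odot>\<^bsub>A\<^esub> mv_pow A x n"

definition mv_power :: "('a, 'm) mv_scheme \<Rightarrow> 't set \<Rightarrow> ('t \<Rightarrow> 'a) mv"
  where "mv_power A T =
    \<lparr>carrier = T \<rightarrow>\<^sub>E carrier A,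
     mv_plus = (\<lambda>p q. \<lambda>t\<in>T. p t \<oplus>\<^bsub>A\<^esub> q t),
     mv_neg = (\<lambda>p. \<lambda>t\<in>T. \<sim>\<^bsub>A\<^esub> p t),
     mv_zero = (\<lambda>t\<in>T. \<zero>\<^bsub>A\<^esub>)\<rparr>"

text \<open>The truncated product, the unit and the order are derived from the three basic operations;
  for the dual algebra they become the sum, the zero and the reversed order of the original.\<close>

definition mv_op :: "('a, 'm) mv_scheme \<Rightarrow> 'a mv"
  where "mv_op A =
    \<lparr>carrier = carrier A, mv_plus = (\<odot>\<^bsub>A\<^esub>), mv_neg = mv_neg A, mv_zero = \<one>\<^bsub>A\<^esub>\<rparr>"


section \<open>fm-functions\<close>

locale fm_function = dom: mv_algebra A + cod: mv_algebra B
  for A (structure) and B (structure) and G +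
  assumes closed: "G \<in> carrier A \<rightarrow> carrier B"
    and FM1: "G \<one>\<^bsub>A\<^esub> = \<one>\<^bsub>B\<^esub>"
    and FM2: "\<lbrakk>x \<in> carrier A; y \<in> carrier A; x \<sqsubseteq>\<^bsub>mv_order A\<^esub> y\<rbrakk>
      \<Longrightarrow> G x \<sqsubseteq>\<^bsub>mv_order B\<^esub> G y"
    and FM3: "\<lbrakk>x \<in> carrier A; y \<in> carrier A; G x = \<one>\<^bsub>B\<^esub>; G y = \<one>\<^bsub>B\<^esub>\<rbrakk>
      \<Longrightarrow> G (x \<odot>\<^bsub>A\<^esub> y) = \<one>\<^bsub>B\<^esub>"
    and FM4: "x \<in> carrier A \<Longrightarrow> G x \<odot>\<^bsub>B\<^esub> G x = G (x \<odot>\<^bsub>A\<^esub> x)"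
    and FM5: "x \<in> carrier A \<Longrightarrow> G x \<oplus>\<^bsub>B\<^esub> G x = G (x \<oplus>\<^bsub>A\<^esub> x)"

locale strong_fm_function = fm_function +
  assumes FM6: "\<lbrakk>x \<in> carrier A; y \<in> carrier A\<rbrakk>
      \<Longrightarrow> G x \<odot>\<^bsub>B\<^esub> G y \<sqsubseteq>\<^bsub>mv_order B\<^esub> G (x \<odot>\<^bsub>A\<^esub> y)"
    and FM7: "\<lbrakk>x \<in> carrier A; y \<in> carrier A\<rbrakk>
      \<Longrightarrow> G x \<oplus>\<^bsub>B\<^esub> G y \<sqsubseteq>\<^bsub>mv_order B\<^esub> G (x \<oplus>\<^bsub>A\<^esub> y)"
    and FM8: "\<lbrakk>x \<in> carrier A; y \<in> carrier A\<rbrakk>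
      \<Longrightarrow> G x \<sqinter>\<^bsub>mv_order B\<^esub> G y = G (x \<sqinter>\<^bsub>mv_order A\<^esub> y)"
    and FM9: "\<lbrakk>x \<in> carrier A; n \<ge> 1\<rbrakk> \<Longrightarrow> G (mv_pow A x n) = mv_pow B (G x) n"
    and FM10: "\<lbrakk>x \<in> carrier A; n \<ge> 1\<rbrakk> \<Longrightarrow> mv_multiple B n (G x) = G (mv_multiple A n x)"

text \<open>\<open>P\<close> is left adjoint to \<open>G\<close>: maps \<open>G\<close> from \<open>A\<close> to \<open>B\<close> and \<open>P\<close> from \<open>B\<close> to \<open>A\<close> with
  \<open>q \<le> G p\<close> iff \<open>P q \<le> p\<close>.\<close>

definition left_adjoint ::
  "('a, 'm) mv_scheme \<Rightarrow> ('b, 'n) mv_scheme \<Rightarrow> ('a \<Rightarrow> 'b) \<Rightarrow> ('b \<Rightarrow> 'a) \<Rightarrow> bool"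
  where "left_adjoint A B G P \<longleftrightarrow>
    galois_connection \<lparr>orderA = mv_order B, orderB = mv_order A, lower = P, upper = G\<rparr>"


section \<open>Frames\<close>

definition frame :: "'s set \<Rightarrow> 't set \<Rightarrow> ('s \<times> 't) set \<Rightarrow> bool"
  where "frame S T R \<longleftrightarrow> S \<noteq> {} \<and> T \<noteq> {} \<and> R \<subseteq> S \<times> T"

definition G_star ::
  "('a, 'm) mv_scheme \<Rightarrow> 's set \<Rightarrow> 't set \<Rightarrow> ('s \<times> 't) set \<Rightarrow> ('t \<Rightarrow> 'a) \<Rightarrow> 's \<Rightarrow> 'a"
  where "G_star M S T R p = (\<lambda>s\<in>S. \<Sqinter>\<^bsub>mv_order M\<^esub> {p t | t. t \<in> T \<and> (s, t) \<in> R})"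

end

theory Submission
  imports Defs
begin

text \<open>Since \<open>G\<^sup>*(p)(s)\<close> is the infimum of the family \<open>p\<close> over the successors of \<open>s\<close>, and powers
  carry componentwise operations, each condition on \<open>G\<^sup>*\<close> becomes a statement on infima of
  families in \<open>M\<close>. Monotonicity alone gives the inequalities for \<open>\<odot>\<close> and \<open>\<oplus>\<close>, and infima
  commute with binary meets.

  The equalities for \<open>x\<^sup>n\<close> and \<open>n \<times> x\<close> rest on linearity. In a complete MV-chain both \<open>x \<oplus> _\<close> and
  \<open>x \<odot> _\<close> preserve non-empty infima (\<open>plus_mv_Inf\<close>, \<open>times_mv_Inf\<close>). So the product of
  two infima is the infimum of all mixed products \<open>f i \<odot> g j\<close>, and when \<open>g i\<close> increases with
  \<open>f i\<close>, each mixed product dominates a diagonal one \<open>f k \<odot> g k\<close> (\<open>mv_Inf_comonotone\<close>).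
  Taking \<open>g i = (f i)\<^sup>n\<close>, induction on \<open>n\<close> shows that powers, and in the same way multiples,
  commute with infima. A point without successors gives the infimum \<open>1\<close>, which is fixed
  by powers and by multiples with \<open>n \<ge> 1\<close>.

  The statement on \<open>P\<^sup>*\<close> is the same statement for the dual chain: the dual of a power is
  the power of the dual (\<open>mv_op_power\<close>), infima in the dual are suprema, and so the operator
  \<open>G\<^sup>*\<close> formed in \<open>M\<^sup>o\<^sup>p\<close> for the converse relation sends \<open>q\<close> to the suprema of \<open>q\<close> over
  predecessors. It is left adjoint to \<open>G\<^sup>*\<close> because both \<open>P\<^sup>*(q) \<le> p\<close> and \<open>q \<le> G\<^sup>*(p)\<close> say that
  \<open>q(s) \<le> p(t)\<close> whenever \<open>sRt\<close>. Left adjoints are unique, so every left adjoint is this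
  operator.\<close>


section \<open>The order of an MV-algebra\<close>

lemma carrier_mv_order [simp]: "carrier (mv_order A) = carrier A"
  by (simp add: mv_order_def)

lemma eq_mv_order [simp]: "eq (mv_order A) = (=)"
  by (simp add: mv_order_def)

lemma mv_order_le_iff: "x \<sqsubseteq>\<^bsub>mv_order A\<^esub> y \<longleftrightarrow> \<sim>\<^bsub>A\<^esub> x \<oplus>\<^bsub>A\<^esub> y = \<one>\<^bsub>A\<^esub>"
  by (simp add: mv_order_def)

context mv_algebra
begin

abbreviation mv_le :: "'a \<Rightarrow> 'a \<Rightarrow> bool"  (infix \<open>\<preceq>\<close> 50)
  where "x \<preceq> y \<equiv> x \<sqsubseteq>\<^bsub>mv_order A\<^esub> y"

lemma one_closed: "\<one> \<in> carrier A"
  by (simp add: mv_one_def neg_closed zero_closed)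

lemma times_closed: "\<lbrakk>x \<in> carrier A; y \<in> carrier A\<rbrakk> \<Longrightarrow> x \<odot> y \<in> carrier A"
  by (simp add: mv_times_def neg_closed plus_closed)

lemmas closed_rules = plus_closed neg_closed zero_closed one_closed times_closed

lemma neg_zero: "\<sim> \<zero> = \<one>"
  by (simp add: mv_one_def)

lemma neg_one: "\<sim> \<one> = \<zero>"
  by (simp add: mv_one_def neg_neg zero_closed)

lemma neg_times: "\<lbrakk>x \<in> carrier A; y \<in> carrier A\<rbrakk> \<Longrightarrow> \<sim> (x \<odot> y) = \<sim> x \<oplus> \<sim> y"
  by (simp add: mv_times_def closed_rules neg_neg)

lemma zero_plus: "x \<in> carrier A \<Longrightarrow> \<zero> \<oplus> x = x"
  using plus_comm plus_zero zero_closed by simp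

lemma plus_one': "x \<in> carrier A \<Longrightarrow> x \<oplus> \<one> = \<one>"
  using plus_one by (simp add: mv_one_def)

lemma one_plus: "x \<in> carrier A \<Longrightarrow> \<one> \<oplus> x = \<one>"
  using plus_comm plus_one' one_closed by simp

lemma times_comm: "\<lbrakk>x \<in> carrier A; y \<in> carrier A\<rbrakk> \<Longrightarrow> x \<odot> y = y \<odot> x"
  by (simp add: mv_times_def plus_comm closed_rules)

lemma times_assoc:
  "\<lbrakk>x \<in> carrier A; y \<in> carrier A; z \<in> carrier A\<rbrakk> \<Longrightarrow> (x \<odot> y) \<odot> z = x \<odot> (y \<odot> z)"
  by (simp add: mv_times_def closed_rules neg_neg plus_assoc)

lemma times_one: "x \<in> carrier A \<Longrightarrow> x \<odot> \<one> = x"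
  by (simp add: mv_times_def neg_one plus_zero closed_rules neg_neg)

lemma times_zero: "x \<in> carrier A \<Longrightarrow> x \<odot> \<zero> = \<zero>"
  by (simp add: mv_times_def neg_zero plus_one' closed_rules neg_one)

lemma neg_plus_self:
  assumes "x \<in> carrier A"
  shows "\<sim> x \<oplus> x = \<one>"
proof -
  have "\<sim> (\<sim> x \<oplus> \<one>) \<oplus> \<one> = \<sim> (\<sim> \<one> \<oplus> x) \<oplus> x"
    using assms one_closed by (rule lukasiewicz)
  then show ?thesis
    using assms by (simp add: closed_rules plus_one' neg_one zero_plus)
qed

lemma le_antisym:
  assumes "x \<in> carrier A" "y \<in> carrier A" "x \<preceq> y" "y \<preceq> x"
  shows "x = y"
  using lukasiewicz[OF assms(1,2)] assms by (simp add: mv_order_le_iff neg_one zero_plus)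

lemma times_neg_self: "x \<in> carrier A \<Longrightarrow> x \<odot> \<sim> x = \<zero>"
  by (simp add: mv_times_def neg_neg neg_plus_self neg_one)

text \<open>Both sides of the Lukasiewicz identity are the join of the two elements. If \<open>x \<preceq> y\<close>, the
  join is \<open>y\<close>, which exhibits \<open>y\<close> as \<open>x \<oplus> \<not>(\<not>y \<oplus> x)\<close>. Hence the order is the
  divisibility order of \<open>\<oplus>\<close>; transitivity and monotonicity of \<open>\<oplus>\<close> follow at once.\<close>

lemma le_obtain_plus:
  assumes "x \<in> carrier A" "y \<in> carrier A" "x \<preceq> y"
  obtains w where "w \<in> carrier A" "y = x \<oplus> w"
proof
  show "\<sim> (\<sim> y \<oplus> x) \<in> carrier A"
    using assms by (simp add: closed_rules)
  show "y = x \<oplus> \<sim> (\<sim> y \<oplus> x)"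
    using lukasiewicz[OF assms(1,2)] assms
    by (simp add: mv_order_le_iff neg_one zero_plus plus_zero plus_comm closed_rules)
qed

lemma le_plus_left: "\<lbrakk>x \<in> carrier A; w \<in> carrier A\<rbrakk> \<Longrightarrow> x \<preceq> x \<oplus> w"
  by (simp add: mv_order_le_iff neg_plus_self one_plus closed_rules flip: plus_assoc)

lemma le_trans:
  assumes "x \<in> carrier A" "y \<in> carrier A" "z \<in> carrier A" "x \<preceq> y" "y \<preceq> z"
  shows "x \<preceq> z"
proof -
  obtain v w where "v \<in> carrier A" "w \<in> carrier A" "y = x \<oplus> v" "z = y \<oplus> w"
    using assms le_obtain_plus by metis
  then show ?thesis
    using assms(1) by (simp add: plus_assoc le_plus_left closed_rules)
qed

lemma partial_order_mv_order: "partial_order (mv_order A)"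
proof unfold_locales
  show "x .=\<^bsub>mv_order A\<^esub> y" if "x \<sqsubseteq>\<^bsub>mv_order A\<^esub> y" "y \<sqsubseteq>\<^bsub>mv_order A\<^esub> x"
    "x \<in> carrier (mv_order A)" "y \<in> carrier (mv_order A)" for x y
    using that le_antisym[of x y] by simp
  show "x \<sqsubseteq>\<^bsub>mv_order A\<^esub> x" if "x \<in> carrier (mv_order A)" for x
    using that by (simp add: mv_order_le_iff neg_plus_self)
  show "x \<sqsubseteq>\<^bsub>mv_order A\<^esub> z" if "x \<sqsubseteq>\<^bsub>mv_order A\<^esub> y" "y \<sqsubseteq>\<^bsub>mv_order A\<^esub> z"
    "x \<in> carrier (mv_order A)" "y \<in> carrier (mv_order A)" "z \<in> carrier (mv_order A)" for x y z
    using that le_trans[of x y z] by simp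
qed simp_all

lemma le_refl: "x \<in> carrier A \<Longrightarrow> x \<preceq> x"
  by (simp add: mv_order_le_iff neg_plus_self)

lemma le_one: "x \<in> carrier A \<Longrightarrow> x \<preceq> \<one>"
  by (simp add: mv_order_le_iff plus_one' closed_rules)

lemma zero_le: "x \<in> carrier A \<Longrightarrow> \<zero> \<preceq> x"
  by (simp add: mv_order_le_iff neg_zero one_plus)

lemma plus_right_mono:
  assumes "x \<in> carrier A" "y \<in> carrier A" "z \<in> carrier A" "x \<preceq> y"
  shows "z \<oplus> x \<preceq> z \<oplus> y"
proof -
  obtain w where "w \<in> carrier A" "y = x \<oplus> w"
    using assms le_obtain_plus by metis
  then show ?thesis
    using assms(1,3) by (simp add: le_plus_left closed_rules flip: plus_assoc)
qed

lemma neg_le_neg_iff: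
  "\<lbrakk>x \<in> carrier A; y \<in> carrier A\<rbrakk> \<Longrightarrow> \<sim> y \<preceq> \<sim> x \<longleftrightarrow> x \<preceq> y"
  by (simp add: mv_order_le_iff neg_neg plus_comm closed_rules)

lemma times_right_mono:
  assumes "x \<in> carrier A" "y \<in> carrier A" "z \<in> carrier A" "x \<preceq> y"
  shows "z \<odot> x \<preceq> z \<odot> y"
  using assms by (simp add: mv_times_def neg_le_neg_iff plus_right_mono closed_rules)

lemma plus_mono:
  assumes "x \<in> carrier A" "y \<in> carrier A" "u \<in> carrier A" "v \<in> carrier A" "x \<preceq> y" "u \<preceq> v"
  shows "x \<oplus> u \<preceq> y \<oplus> v"
  using assms plus_right_mono[of u v x] plus_right_mono[of x y v]
    le_trans[of "x \<oplus> u" "x \<oplus> v" "y \<oplus> v"] by (simp add: plus_comm closed_rules)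

lemma times_mono:
  assumes "x \<in> carrier A" "y \<in> carrier A" "u \<in> carrier A" "v \<in> carrier A" "x \<preceq> y" "u \<preceq> v"
  shows "x \<odot> u \<preceq> y \<odot> v"
  using assms times_right_mono[of u v x] times_right_mono[of x y v]
    le_trans[of "x \<odot> u" "x \<odot> v" "y \<odot> v"] by (simp add: times_comm closed_rules)

text \<open>Both sides unfold to the equation \<open>\<not>x \<oplus> \<not>y \<oplus> z = 1\<close>.\<close>

lemma residuation:
  assumes "x \<in> carrier A" "y \<in> carrier A" "z \<in> carrier A"
  shows "x \<odot> y \<preceq> z \<longleftrightarrow> y \<preceq> \<sim> x \<oplus> z"
proof -
  have "\<sim> (x \<odot> y) \<oplus> z = \<sim> y \<oplus> (\<sim> x \<oplus> z)"
    using assms by (simp add: neg_times closed_rules plus_comm[of "\<sim> x" "\<sim> y"] plus_assoc)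
  then show ?thesis
    by (simp add: mv_order_le_iff)
qed

text \<open>Up to commutativity, \<open>x \<odot> (\<not>x \<oplus> z)\<close> is the negation of the Lukasiewicz term for the join of
  \<open>\<not>x\<close> and \<open>\<not>z\<close>, so it is the meet of \<open>x\<close> and \<open>z\<close>.\<close>

lemma divisibility:
  assumes "x \<in> carrier A" "z \<in> carrier A" "z \<preceq> x"
  shows "x \<odot> (\<sim> x \<oplus> z) = z"
proof -
  have "\<sim> (\<sim> (\<sim> z) \<oplus> \<sim> x) \<oplus> \<sim> x = \<sim> (\<sim> (\<sim> x) \<oplus> \<sim> z) \<oplus> \<sim> z"
    using assms by (simp add: lukasiewicz closed_rules)
  moreover have "x \<oplus> \<sim> z = \<one>"
    using assms by (simp add: mv_order_le_iff plus_comm closed_rules)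
  ultimately have "\<sim> (z \<oplus> \<sim> x) \<oplus> \<sim> x = \<sim> z"
    using assms by (simp add: neg_neg neg_one zero_plus closed_rules)
  then show ?thesis
    using assms by (simp add: mv_times_def neg_neg plus_comm closed_rules)
qed

text \<open>The element \<open>\<not>x \<oplus> (x \<odot> y)\<close> is the join of \<open>\<not>x\<close> and \<open>y\<close>; for comparable elements it
  is the larger one.\<close>

lemma neg_plus_times_eq:
  assumes "x \<in> carrier A" "y \<in> carrier A"
  shows "y \<preceq> \<sim> x \<Longrightarrow> \<sim> x \<oplus> x \<odot> y = \<sim> x"
    and "\<sim> x \<preceq> y \<Longrightarrow> \<sim> x \<oplus> x \<odot> y = y"
  using assms lukasiewicz[of "\<sim> x" y]
  by (simp_all add: mv_order_le_iff mv_times_def neg_neg neg_one plus_zero zero_plus plus_comm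
      closed_rules)

lemma mv_pow_closed: "x \<in> carrier A \<Longrightarrow> mv_pow A x n \<in> carrier A"
  by (induction n) (auto simp: closed_rules)

lemma mv_multiple_closed: "x \<in> carrier A \<Longrightarrow> mv_multiple A n x \<in> carrier A"
  by (induction n) (auto simp: closed_rules)

lemma mv_pow_mono:
  "\<lbrakk>x \<in> carrier A; y \<in> carrier A; x \<preceq> y\<rbrakk> \<Longrightarrow> mv_pow A x n \<preceq> mv_pow A y n"
  by (induction n) (auto simp: closed_rules times_mono mv_pow_closed le_refl)

lemma mv_multiple_mono:
  "\<lbrakk>x \<in> carrier A; y \<in> carrier A; x \<preceq> y\<rbrakk> \<Longrightarrow> mv_multiple A n x \<preceq> mv_multiple A n y"
  by (induction n) (auto simp: closed_rules plus_mono mv_multiple_closed le_refl)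

lemma Inf_mv_eqI:
  assumes "is_glb (mv_order A) x X"
  shows "\<Sqinter>\<^bsub>mv_order A\<^esub> X = x"
proof -
  interpret partial_order "mv_order A"
    by (rule partial_order_mv_order)
  show ?thesis
    unfolding inf_def
  proof (rule some_equality)
    show "y = x" if "is_glb (mv_order A) y X" for y
      using weak_greatest_unique[OF that assms] by simp
  qed (fact assms)
qed

end


section \<open>Dual MV-algebras\<close>

lemma mv_op_simps [simp]:
  "carrier (mv_op A) = carrier A"
  "x \<oplus>\<^bsub>mv_op A\<^esub> y = x \<odot>\<^bsub>A\<^esub> y"
  "\<sim>\<^bsub>mv_op A\<^esub> x = \<sim>\<^bsub>A\<^esub> x"
  "\<zero>\<^bsub>mv_op A\<^esub> = \<one>\<^bsub>A\<^esub>"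
  by (simp_all add: mv_op_def)

context mv_algebra
begin

lemma mv_one_op: "\<one>\<^bsub>mv_op A\<^esub> = \<zero>"
  by (simp add: mv_one_def[of "mv_op A"] neg_one)

lemma mv_algebra_op: "mv_algebra (mv_op A)"
proof (rule mv_algebra.intro)
  show "\<sim>\<^bsub>mv_op A\<^esub> (\<sim>\<^bsub>mv_op A\<^esub> x \<oplus>\<^bsub>mv_op A\<^esub> y) \<oplus>\<^bsub>mv_op A\<^esub> y =
      \<sim>\<^bsub>mv_op A\<^esub> (\<sim>\<^bsub>mv_op A\<^esub> y \<oplus>\<^bsub>mv_op A\<^esub> x) \<oplus>\<^bsub>mv_op A\<^esub> x"
    if "x \<in> carrier (mv_op A)" "y \<in> carrier (mv_op A)" for x y
    using that lukasiewicz[of "\<sim> x" "\<sim> y"]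
    by (simp add: mv_times_def closed_rules neg_neg)
qed (simp_all add: closed_rules times_assoc times_one neg_neg neg_one times_zero,
    rule times_comm)

lemma neg_eq_zero_iff: "x \<in> carrier A \<Longrightarrow> \<sim> x = \<zero> \<longleftrightarrow> x = \<one>"
  using neg_neg[of x] neg_one neg_zero by metis

lemma mv_order_op_le_iff:
  assumes "x \<in> carrier A" "y \<in> carrier A"
  shows "x \<sqsubseteq>\<^bsub>mv_order (mv_op A)\<^esub> y \<longleftrightarrow> y \<preceq> x"
proof -
  have "\<sim> x \<odot> y = \<sim> (\<sim> y \<oplus> x)"
    using assms by (simp add: mv_times_def neg_neg plus_comm[of x] neg_closed)
  then show ?thesis
    using assms by (simp add: mv_order_le_iff mv_one_op neg_eq_zero_iff closed_rules)
qed

lemma is_glb_op_iff: "is_glb (mv_order (mv_op A)) x X \<longleftrightarrow> is_lub (mv_order A) x X"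
  unfolding greatest_def least_def Lower_def Upper_def
  using mv_order_op_le_iff by auto

lemma is_lub_op_iff: "is_lub (mv_order (mv_op A)) x X \<longleftrightarrow> is_glb (mv_order A) x X"
  unfolding greatest_def least_def Lower_def Upper_def
  using mv_order_op_le_iff by auto

lemma Inf_op: "\<Sqinter>\<^bsub>mv_order (mv_op A)\<^esub> X = \<Squnion>\<^bsub>mv_order A\<^esub> X"
  by (simp add: inf_def sup_def is_glb_op_iff)

end


section \<open>Powers of MV-algebras\<close>

lemma carrier_mv_power [simp]: "carrier (mv_power M T) = T \<rightarrow>\<^sub>E carrier M"
  by (simp add: mv_power_def)

lemma mv_power_ops:
  "p \<oplus>\<^bsub>mv_power M T\<^esub> q = (\<lambda>t\<in>T. p t \<oplus>\<^bsub>M\<^esub> q t)"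
  "\<sim>\<^bsub>mv_power M T\<^esub> p = (\<lambda>t\<in>T. \<sim>\<^bsub>M\<^esub> p t)"
  "\<zero>\<^bsub>mv_power M T\<^esub> = (\<lambda>t\<in>T. \<zero>\<^bsub>M\<^esub>)"
  "\<one>\<^bsub>mv_power M T\<^esub> = (\<lambda>t\<in>T. \<one>\<^bsub>M\<^esub>)"
  "p \<odot>\<^bsub>mv_power M T\<^esub> q = (\<lambda>t\<in>T. p t \<odot>\<^bsub>M\<^esub> q t)"
  by (auto simp: mv_power_def mv_one_def mv_times_def cong: restrict_cong)

lemma mv_power_le_iff:
  "p \<sqsubseteq>\<^bsub>mv_order (mv_power M T)\<^esub> q \<longleftrightarrow> (\<forall>t\<in>T. p t \<sqsubseteq>\<^bsub>mv_order M\<^esub> q t)"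
  by (auto simp: mv_order_le_iff mv_power_ops fun_eq_iff restrict_def)

lemma mv_pow_power: "mv_pow (mv_power M T) p n = (\<lambda>t\<in>T. mv_pow M (p t) n)"
  by (induction n) (auto simp: mv_power_ops cong: restrict_cong)

lemma mv_multiple_power: "mv_multiple (mv_power M T) n p = (\<lambda>t\<in>T. mv_multiple M n (p t))"
  by (induction n) (auto simp: mv_power_ops cong: restrict_cong)

lemma (in mv_algebra) mv_algebra_power: "mv_algebra (mv_power A T)"
proof (rule mv_algebra.intro)
  fix p q assume p: "p \<in> carrier (mv_power A T)" and q: "q \<in> carrier (mv_power A T)"
  have pq: "p t \<in> carrier A" "q t \<in> carrier A" if "t \<in> T" for t
    using p q that by auto
  show "\<sim>\<^bsub>mv_power A T\<^esub> (\<sim>\<^bsub>mv_power A T\<^esub> p \<oplus>\<^bsub>mv_power A T\<^esub> q) \<oplus>\<^bsub>mv_power A T\<^esub> q =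
      \<sim>\<^bsub>mv_power A T\<^esub> (\<sim>\<^bsub>mv_power A T\<^esub> q \<oplus>\<^bsub>mv_power A T\<^esub> p) \<oplus>\<^bsub>mv_power A T\<^esub> p"
    unfolding mv_power_ops by (rule restrict_ext) (simp add: pq lukasiewicz)
  show "p \<oplus>\<^bsub>mv_power A T\<^esub> q = q \<oplus>\<^bsub>mv_power A T\<^esub> p"
    unfolding mv_power_ops by (rule restrict_ext) (simp add: pq plus_comm)
  show "p \<oplus>\<^bsub>mv_power A T\<^esub> q \<in> carrier (mv_power A T)"
    by (simp add: mv_power_ops pq plus_closed)
  show "(p \<oplus>\<^bsub>mv_power A T\<^esub> q) \<oplus>\<^bsub>mv_power A T\<^esub> r = p \<oplus>\<^bsub>mv_power A T\<^esub> (q \<oplus>\<^bsub>mv_power A T\<^esub> r)"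
    if "r \<in> carrier (mv_power A T)" for r
  proof -
    have "r t \<in> carrier A" if "t \<in> T" for t
      using \<open>r \<in> carrier (mv_power A T)\<close> that by auto
    then show ?thesis
      unfolding mv_power_ops by (intro restrict_ext) (simp add: pq plus_assoc)
  qed
next
  fix p assume "p \<in> carrier (mv_power A T)"
  then have p: "\<And>t. t \<in> T \<Longrightarrow> p t \<in> carrier A" and ext: "restrict p T = p"
    by (auto simp: PiE_restrict)
  show "\<sim>\<^bsub>mv_power A T\<^esub> p \<in> carrier (mv_power A T)"
    by (simp add: mv_power_ops p neg_closed)
  show "p \<oplus>\<^bsub>mv_power A T\<^esub> \<zero>\<^bsub>mv_power A T\<^esub> = p"
    using ext by (simp add: mv_power_ops p plus_zero cong: restrict_cong)
  show "\<sim>\<^bsub>mv_power A T\<^esub> (\<sim>\<^bsub>mv_power A T\<^esub> p) = p"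
    using ext by (simp add: mv_power_ops p neg_neg cong: restrict_cong)
  show "p \<oplus>\<^bsub>mv_power A T\<^esub> \<sim>\<^bsub>mv_power A T\<^esub> \<zero>\<^bsub>mv_power A T\<^esub> =
      \<sim>\<^bsub>mv_power A T\<^esub> \<zero>\<^bsub>mv_power A T\<^esub>"
    unfolding mv_power_ops by (rule restrict_ext) (simp add: p plus_one)
qed (simp add: mv_power_ops zero_closed)

text \<open>This equality of structures lets results on powers of a chain be applied to their duals.\<close>

lemma mv_op_power: "mv_op (mv_power M T) = mv_power (mv_op M) T"
  by (simp add: mv_op_def mv_power_ops) (simp add: mv_power_def mv_one_def mv_times_def fun_eq_iff)


section \<open>Infima in complete MV-chains\<close>

locale complete_mv_chain = mv_algebra +
  assumes total: "total_order (mv_order A)"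
    and complete: "complete_lattice (mv_order A)"
begin

lemma linear: "\<lbrakk>x \<in> carrier A; y \<in> carrier A\<rbrakk> \<Longrightarrow> x \<preceq> y \<or> y \<preceq> x"
  using total_order.total_order_total[OF total] by simp

definition mv_Inf :: "'i set \<Rightarrow> ('i \<Rightarrow> 'a) \<Rightarrow> 'a"
  where "mv_Inf I f = \<Sqinter>\<^bsub>mv_order A\<^esub> (f ` I)"

lemma is_glb_Inf:
  assumes "X \<subseteq> carrier A"
  shows "is_glb (mv_order A) (\<Sqinter>\<^bsub>mv_order A\<^esub> X) X"
proof -
  interpret complete_lattice "mv_order A"
    by (rule complete)
  show ?thesis
    by (rule inf_glb) (simp add: assms)
qed

lemma mv_Inf_closed:
  assumes "f \<in> I \<rightarrow> carrier A"
  shows "mv_Inf I f \<in> carrier A"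
  using is_glb_Inf[of "f ` I"] assms unfolding mv_Inf_def greatest_def by auto

lemma le_mv_Inf_iff:
  assumes f: "f \<in> I \<rightarrow> carrier A" and z: "z \<in> carrier A"
  shows "z \<preceq> mv_Inf I f \<longleftrightarrow> (\<forall>i\<in>I. z \<preceq> f i)"
proof -
  have glb: "is_glb (mv_order A) (mv_Inf I f) (f ` I)"
    unfolding mv_Inf_def using f by (intro is_glb_Inf) auto
  have below: "mv_Inf I f \<preceq> f i" if "i \<in> I" for i
    using greatest_Lower_below[OF glb] f that by auto
  show ?thesis
  proof
    assume "z \<preceq> mv_Inf I f"
    then show "\<forall>i\<in>I. z \<preceq> f i"
      using below f z mv_Inf_closed[OF f] le_trans by blast
  next
    assume "\<forall>i\<in>I. z \<preceq> f i"
    then have "z \<in> Lower (mv_order A) (f ` I)"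
      using z by (auto simp: Lower_def)
    then show "z \<preceq> mv_Inf I f"
      using glb by (simp add: greatest_def)
  qed
qed

lemma mv_Inf_lower: "\<lbrakk>f \<in> I \<rightarrow> carrier A; i \<in> I\<rbrakk> \<Longrightarrow> mv_Inf I f \<preceq> f i"
  using le_mv_Inf_iff[of f I "mv_Inf I f"] mv_Inf_closed le_refl by blast

lemma mv_Inf_eqI:
  assumes "f \<in> I \<rightarrow> carrier A" "x \<in> carrier A"
    and "\<And>z. z \<in> carrier A \<Longrightarrow> z \<preceq> x \<longleftrightarrow> (\<forall>i\<in>I. z \<preceq> f i)"
  shows "mv_Inf I f = x"
proof (rule le_antisym)
  show inf: "mv_Inf I f \<in> carrier A"
    using assms(1) by (rule mv_Inf_closed)
  show "mv_Inf I f \<preceq> x"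
    using assms(1) inf by (simp add: assms(3) mv_Inf_lower)
  show "x \<preceq> mv_Inf I f"
    using assms(3)[OF assms(2)] by (simp add: le_mv_Inf_iff[OF assms(1,2)] le_refl[OF assms(2)])
qed (fact assms(2))

lemma mv_Inf_cong: "(\<And>i. i \<in> I \<Longrightarrow> f i = g i) \<Longrightarrow> mv_Inf I f = mv_Inf I g"
  by (simp add: mv_Inf_def cong: image_cong)

lemma mv_Inf_empty: "mv_Inf {} f = \<one>"
  by (rule mv_Inf_eqI) (auto simp: le_one one_closed)

lemma mv_Inf_one: "mv_Inf I (\<lambda>i. \<one>) = \<one>"
  by (rule mv_Inf_eqI) (auto simp: le_one one_closed)

lemma mv_Inf_const: "\<lbrakk>I \<noteq> {}; x \<in> carrier A\<rbrakk> \<Longrightarrow> mv_Inf I (\<lambda>i. x) = x"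
  by (rule mv_Inf_eqI) auto

text \<open>By residuation \<open>x \<oplus> _\<close> has the left adjoint \<open>\<not>x \<odot> _\<close>, so it preserves all infima.\<close>

lemma plus_mv_Inf:
  assumes "f \<in> I \<rightarrow> carrier A" "x \<in> carrier A"
  shows "mv_Inf I (\<lambda>i. x \<oplus> f i) = x \<oplus> mv_Inf I f"
proof (rule mv_Inf_eqI)
  fix z assume "z \<in> carrier A"
  then have res: "z \<preceq> x \<oplus> y \<longleftrightarrow> \<sim> x \<odot> z \<preceq> y" if "y \<in> carrier A" for y
    using residuation[of "\<sim> x" z y] assms that by (simp add: closed_rules neg_neg)
  show "z \<preceq> x \<oplus> mv_Inf I f \<longleftrightarrow> (\<forall>i\<in>I. z \<preceq> x \<oplus> f i)"
    using assms \<open>z \<in> carrier A\<close> res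
    by (simp add: Pi_iff mv_Inf_closed le_mv_Inf_iff closed_rules)
qed (use assms in \<open>auto simp: closed_rules mv_Inf_closed Pi_iff\<close>)

text \<open>Here residuation does not help, because it makes \<open>x \<odot> _\<close> preserve suprema. A lower
  bound \<open>z\<close> of all \<open>x \<odot> f i\<close> satisfies \<open>z = x \<odot> u\<close> with \<open>u = \<not>x \<oplus> z\<close> by divisibility,
  and \<open>u\<close> lies below every \<open>\<not>x \<oplus> (x \<odot> f i)\<close>, which is the larger of \<open>\<not>x\<close> and \<open>f i\<close>.
  Either \<open>u \<le> \<not>x\<close>, and then \<open>z = 0\<close>, or \<open>u\<close> is a lower bound of all \<open>f i\<close>. For an
  empty index set the equation would read \<open>1 = x\<close>.\<close>

lemma times_mv_Inf:
  assumes f: "f \<in> I \<rightarrow> carrier A" and x: "x \<in> carrier A" and "I \<noteq> {}"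
  shows "mv_Inf I (\<lambda>i. x \<odot> f i) = x \<odot> mv_Inf I f"
proof (rule mv_Inf_eqI)
  fix z assume z: "z \<in> carrier A"
  have fi: "f i \<in> carrier A" if "i \<in> I" for i
    using f that by auto
  have inf: "mv_Inf I f \<in> carrier A"
    by (rule mv_Inf_closed[OF f])
  show "z \<preceq> x \<odot> mv_Inf I f \<longleftrightarrow> (\<forall>i\<in>I. z \<preceq> x \<odot> f i)"
  proof
    assume le: "z \<preceq> x \<odot> mv_Inf I f"
    show "\<forall>i\<in>I. z \<preceq> x \<odot> f i"
    proof
      fix i assume i: "i \<in> I"
      have "x \<odot> mv_Inf I f \<preceq> x \<odot> f i"
        using mv_Inf_lower[OF f i] inf fi[OF i] x by (simp add: times_right_mono)
      then show "z \<preceq> x \<odot> f i"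
        using le z x inf fi[OF i] le_trans times_closed by meson
    qed
  next
    assume lower: "\<forall>i\<in>I. z \<preceq> x \<odot> f i"
    let ?u = "\<sim> x \<oplus> z"
    have u: "?u \<in> carrier A" and nx: "\<sim> x \<in> carrier A"
      using x z by (simp_all add: closed_rules)
    obtain i where i: "i \<in> I"
      using \<open>I \<noteq> {}\<close> by blast
    have "x \<odot> f i \<preceq> x"
      using times_right_mono[of "f i" \<one> x] fi[OF i] x
      by (simp add: one_closed le_one times_one)
    then have "z \<preceq> x"
      using lower i fi[OF i] x z le_trans[of z "x \<odot> f i" x] by (simp add: times_closed)
    then have z_eq: "x \<odot> ?u = z"
      using x z by (simp add: divisibility)
    show "z \<preceq> x \<odot> mv_Inf I f"
    proof (cases "?u \<preceq> \<sim> x")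
      case True
      then have "z \<preceq> x \<odot> \<sim> x"
        using times_right_mono[OF u nx x] z_eq by simp
      also have "x \<odot> \<sim> x = \<zero>"
        using x by (rule times_neg_self)
      finally have "z = \<zero>"
        using z by (simp add: le_antisym zero_le zero_closed)
      then show ?thesis
        using x inf by (simp add: zero_le times_closed)
    next
      case False
      have "?u \<preceq> f j" if j: "j \<in> I" for j
      proof -
        have "?u \<preceq> \<sim> x \<oplus> x \<odot> f j"
          using lower j x z fi[OF j] by (simp add: plus_right_mono closed_rules)
        with False neg_plus_times_eq[OF x fi[OF j]] linear[OF fi[OF j] nx] show ?thesis
          by auto
      qed
      then have "?u \<preceq> mv_Inf I f"
        using f u by (simp add: le_mv_Inf_iff)
      then show ?thesis
        using times_right_mono[OF u inf x] z_eq by simp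
    qed
  qed
qed (use assms in \<open>auto simp: closed_rules mv_Inf_closed Pi_iff\<close>)

text \<open>As the operation preserves infima in each argument, \<open>mv_Inf I f \<star> mv_Inf I g\<close> is the
  infimum of all mixed terms \<open>f i \<star> g j\<close>. Since \<open>f i\<close> and \<open>f j\<close> are comparable and \<open>g\<close>
  varies in the same direction as \<open>f\<close>, each mixed term dominates a diagonal one, namely that
  of the index at which \<open>f\<close> is smaller. The preservation hypothesis speaks of the given index
  set only, so that it can be met by an operation preserving just the non-empty infima.\<close>

lemma mv_Inf_comonotone:
  fixes star :: "'a \<Rightarrow> 'a \<Rightarrow> 'a"  (infixl \<open>\<star>\<close> 70)
  assumes f: "f \<in> I \<rightarrow> carrier A" and g: "g \<in> I \<rightarrow> carrier A"
    and comonotone: "\<And>i j. \<lbrakk>i \<in> I; j \<in> I; f i \<preceq> f j\<rbrakk> \<Longrightarrow> g i \<preceq> g j"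
    and star_closed: "\<And>x y. \<lbrakk>x \<in> carrier A; y \<in> carrier A\<rbrakk> \<Longrightarrow> x \<star> y \<in> carrier A"
    and star_comm: "\<And>x y. \<lbrakk>x \<in> carrier A; y \<in> carrier A\<rbrakk> \<Longrightarrow> x \<star> y = y \<star> x"
    and star_mono: "\<And>x y z. \<lbrakk>x \<in> carrier A; y \<in> carrier A; z \<in> carrier A; x \<preceq> y\<rbrakk>
      \<Longrightarrow> z \<star> x \<preceq> z \<star> y"
    and star_Inf: "\<And>x h. \<lbrakk>h \<in> I \<rightarrow> carrier A; x \<in> carrier A\<rbrakk>
      \<Longrightarrow> mv_Inf I (\<lambda>i. x \<star> h i) = x \<star> mv_Inf I h"
  shows "mv_Inf I (\<lambda>i. f i \<star> g i) = mv_Inf I f \<star> mv_Inf I g"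
proof (rule mv_Inf_eqI)
  have fi: "f i \<in> carrier A" and gi: "g i \<in> carrier A" if "i \<in> I" for i
    using f g that by auto
  have infs: "mv_Inf I f \<in> carrier A" "mv_Inf I g \<in> carrier A"
    using f g by (simp_all add: mv_Inf_closed)
  have "mv_Inf I f \<star> mv_Inf I g = mv_Inf I g \<star> mv_Inf I f"
    using infs by (rule star_comm)
  also have "\<dots> = mv_Inf I (\<lambda>i. mv_Inf I g \<star> f i)"
    using star_Inf[OF f infs(2)] by simp
  also have "\<dots> = mv_Inf I (\<lambda>i. mv_Inf I (\<lambda>j. f i \<star> g j))"
  proof (rule mv_Inf_cong)
    fix i assume "i \<in> I"
    then show "mv_Inf I g \<star> f i = mv_Inf I (\<lambda>j. f i \<star> g j)"
      using star_comm[OF infs(2) fi] star_Inf[OF g fi] by simp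
  qed
  finally have double: "mv_Inf I f \<star> mv_Inf I g = mv_Inf I (\<lambda>i. mv_Inf I (\<lambda>j. f i \<star> g j))" .
  fix z assume z: "z \<in> carrier A"
  have "z \<preceq> mv_Inf I f \<star> mv_Inf I g \<longleftrightarrow> (\<forall>i\<in>I. \<forall>j\<in>I. z \<preceq> f i \<star> g j)"
    unfolding double using z fi gi
    by (simp add: le_mv_Inf_iff mv_Inf_closed Pi_iff star_closed)
  also have "\<dots> \<longleftrightarrow> (\<forall>i\<in>I. z \<preceq> f i \<star> g i)"
  proof (intro iffI ballI)
    fix i j assume diag: "\<forall>i\<in>I. z \<preceq> f i \<star> g i" and i: "i \<in> I" and j: "j \<in> I"
    from linear[OF fi[OF i] fi[OF j]] have "\<exists>k\<in>I. f k \<star> g k \<preceq> f i \<star> g j"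
    proof
      assume "f i \<preceq> f j"
      then have "f i \<star> g i \<preceq> f i \<star> g j"
        using star_mono[OF gi[OF i] gi[OF j] fi[OF i]] comonotone[OF i j] by simp
      then show ?thesis
        using i by blast
    next
      assume "f j \<preceq> f i"
      then have "f j \<star> g j \<preceq> f i \<star> g j"
        using star_mono[OF fi[OF j] fi[OF i] gi[OF j]]
          star_comm[OF fi[OF j] gi[OF j]] star_comm[OF fi[OF i] gi[OF j]] by simp
      then show ?thesis
        using j by blast
    qed
    then obtain k where k: "k \<in> I" "f k \<star> g k \<preceq> f i \<star> g j"
      by blast
    then show "z \<preceq> f i \<star> g j"
      using le_trans[OF z star_closed[OF fi gi] star_closed[OF fi gi]] diag i j by blast
  qed blast
  finally show "z \<preceq> mv_Inf I f \<star> mv_Inf I g \<longleftrightarrow> (\<forall>i\<in>I. z \<preceq> f i \<star> g i)" .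
qed (use f g in \<open>auto simp: star_closed mv_Inf_closed Pi_iff\<close>)

lemma mv_Inf_pow:
  assumes f: "f \<in> I \<rightarrow> carrier A"
  shows "mv_Inf I (\<lambda>i. mv_pow A (f i) n) = mv_pow A (mv_Inf I f) n"
proof (cases "I = {}")
  case True
  have "mv_pow A \<one> n = \<one>"
    by (induction n) (simp_all add: times_one one_closed)
  then show ?thesis
    by (simp add: True mv_Inf_empty)
next
  case False
  show ?thesis
  proof (induction n)
    case 0
    show ?case
      using False by (simp add: mv_Inf_const one_closed)
  next
    case (Suc n)
    have "mv_Inf I (\<lambda>i. f i \<odot> mv_pow A (f i) n) =
        mv_Inf I f \<odot> mv_Inf I (\<lambda>i. mv_pow A (f i) n)"
      using f False
      by (intro mv_Inf_comonotone[where star = "(\<odot>)"])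
        (simp_all add: Pi_iff mv_pow_closed mv_pow_mono times_closed times_right_mono
          times_mv_Inf, simp add: times_comm)
    then show ?case
      using Suc.IH by simp
  qed
qed

lemma mv_Inf_multiple:
  assumes f: "f \<in> I \<rightarrow> carrier A" and "n \<ge> 1"
  shows "mv_Inf I (\<lambda>i. mv_multiple A n (f i)) = mv_multiple A n (mv_Inf I f)"
proof (cases "I = {}")
  case True
  have "mv_multiple A n \<one> = \<one>"
    \<comment> \<open>The multiple \<open>0 \<times> 1\<close> would be \<open>0\<close>.\<close>
    using \<open>n \<ge> 1\<close> by (cases n) (simp_all add: one_plus one_closed mv_multiple_closed)
  then show ?thesis
    by (simp add: True mv_Inf_empty)
next
  case False
  show ?thesis
  proof (induction n)
    case 0
    show ?case
      using False by (simp add: mv_Inf_const zero_closed)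
  next
    case (Suc n)
    have "mv_Inf I (\<lambda>i. f i \<oplus> mv_multiple A n (f i)) =
        mv_Inf I f \<oplus> mv_Inf I (\<lambda>i. mv_multiple A n (f i))"
      using f
      by (intro mv_Inf_comonotone[where star = "(\<oplus>)"])
        (simp_all add: Pi_iff mv_multiple_closed mv_multiple_mono plus_closed plus_right_mono
          plus_mv_Inf, simp add: plus_comm)
    then show ?case
      using Suc.IH by simp
  qed
qed

lemma le_meet_iff:
  assumes "x \<in> carrier A" "y \<in> carrier A" "z \<in> carrier A"
  shows "z \<preceq> x \<sqinter>\<^bsub>mv_order A\<^esub> y \<longleftrightarrow> z \<preceq> x \<and> z \<preceq> y"
proof -
  have "x \<sqinter>\<^bsub>mv_order A\<^esub> y = mv_Inf {x, y} (\<lambda>i. i)"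
    by (simp add: meet_def mv_Inf_def)
  then show ?thesis
    using assms by (simp add: le_mv_Inf_iff)
qed

lemma meet_closed: "\<lbrakk>x \<in> carrier A; y \<in> carrier A\<rbrakk> \<Longrightarrow> x \<sqinter>\<^bsub>mv_order A\<^esub> y \<in> carrier A"
  using mv_Inf_closed[of "\<lambda>i. i" "{x, y}"] by (simp add: meet_def mv_Inf_def)

lemma meet_power:
  assumes "p \<in> T \<rightarrow>\<^sub>E carrier A" "q \<in> T \<rightarrow>\<^sub>E carrier A"
  shows "p \<sqinter>\<^bsub>mv_order (mv_power A T)\<^esub> q = (\<lambda>t\<in>T. p t \<sqinter>\<^bsub>mv_order A\<^esub> q t)"
proof -
  interpret power: mv_algebra "mv_power A T"
    by (rule mv_algebra_power)
  have pq: "p t \<in> carrier A" "q t \<in> carrier A" if "t \<in> T" for t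
    using assms that by auto
  let ?m = "\<lambda>t\<in>T. p t \<sqinter>\<^bsub>mv_order A\<^esub> q t"
  have le_m: "r \<sqsubseteq>\<^bsub>mv_order (mv_power A T)\<^esub> ?m \<longleftrightarrow>
      r \<sqsubseteq>\<^bsub>mv_order (mv_power A T)\<^esub> p \<and> r \<sqsubseteq>\<^bsub>mv_order (mv_power A T)\<^esub> q"
    if "r \<in> T \<rightarrow>\<^sub>E carrier A" for r
  proof -
    have "r t \<in> carrier A" if "t \<in> T" for t
      using \<open>r \<in> T \<rightarrow>\<^sub>E carrier A\<close> that by auto
    then show ?thesis
      by (auto simp: mv_power_le_iff le_meet_iff pq)
  qed
  have m: "?m \<in> T \<rightarrow>\<^sub>E carrier A"
    using pq by (simp add: meet_closed)
  show ?thesis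
    unfolding meet_def[of "mv_order (mv_power A T)"]
  proof (intro power.Inf_mv_eqI greatest_LowerI)
    show "?m \<sqsubseteq>\<^bsub>mv_order (mv_power A T)\<^esub> r" if "r \<in> {p, q}" for r
      using that le_m[OF m] power.le_refl[of ?m] m by auto
    show "r \<sqsubseteq>\<^bsub>mv_order (mv_power A T)\<^esub> ?m" if "r \<in> Lower (mv_order (mv_power A T)) {p, q}" for r
      using that le_m[of r] assms by (auto simp: Lower_def)
  qed (use assms m in auto)
qed

lemma mv_Inf_meet:
  assumes f: "f \<in> I \<rightarrow> carrier A" and g: "g \<in> I \<rightarrow> carrier A"
  shows "mv_Inf I (\<lambda>i. f i \<sqinter>\<^bsub>mv_order A\<^esub> g i) = mv_Inf I f \<sqinter>\<^bsub>mv_order A\<^esub> mv_Inf I g"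
proof (rule mv_Inf_eqI)
  have fg: "f i \<in> carrier A" "g i \<in> carrier A" if "i \<in> I" for i
    using f g that by auto
  show "z \<preceq> mv_Inf I f \<sqinter>\<^bsub>mv_order A\<^esub> mv_Inf I g \<longleftrightarrow> (\<forall>i\<in>I. z \<preceq> f i \<sqinter>\<^bsub>mv_order A\<^esub> g i)"
    if "z \<in> carrier A" for z
    using that f g fg by (auto simp: le_meet_iff mv_Inf_closed le_mv_Inf_iff)
qed (use f g in \<open>auto simp: meet_closed mv_Inf_closed Pi_iff\<close>)

text \<open>Every \<open>star (f i) (g i)\<close> dominates the left-hand side; this is the source of the inequalities
  \<open>G(x) \<odot> G(y) \<le> G(x \<odot> y)\<close> and \<open>G(x) \<oplus> G(y) \<le> G(x \<oplus> y)\<close>.\<close>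

lemma star_mv_Inf_le:
  assumes f: "f \<in> I \<rightarrow> carrier A" and g: "g \<in> I \<rightarrow> carrier A"
    and star_closed: "\<And>x y. \<lbrakk>x \<in> carrier A; y \<in> carrier A\<rbrakk> \<Longrightarrow> star x y \<in> carrier A"
    and star_mono: "\<And>x y u v. \<lbrakk>x \<in> carrier A; y \<in> carrier A; u \<in> carrier A; v \<in> carrier A;
      x \<preceq> y; u \<preceq> v\<rbrakk> \<Longrightarrow> star x u \<preceq> star y v"
  shows "star (mv_Inf I f) (mv_Inf I g) \<preceq> mv_Inf I (\<lambda>i. star (f i) (g i))"
proof -
  have "\<And>i. i \<in> I \<Longrightarrow> f i \<in> carrier A" "\<And>i. i \<in> I \<Longrightarrow> g i \<in> carrier A"
    using f g by auto
  then show ?thesis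
    using f g by (subst le_mv_Inf_iff) (auto simp: star_closed star_mono mv_Inf_closed mv_Inf_lower)
qed


section \<open>The operators of a frame\<close>

lemma G_star_eq_mv_Inf:
  "G_star A S T R p = (\<lambda>s\<in>S. mv_Inf {t \<in> T. (s, t) \<in> R} p)"
  by (simp add: G_star_def mv_Inf_def setcompr_eq_image)

text \<open>The operator is prescribed on the carrier only, so that the lemma also covers a left adjoint,
  whose values elsewhere are arbitrary.\<close>

lemma strong_fm_function_mv_Inf:
  assumes G: "\<And>p. p \<in> carrier (mv_power A T) \<Longrightarrow> G p = G_star A S T R p"
  shows "strong_fm_function (mv_power A T) (mv_power A S) G"
proof -
  interpret dom: mv_algebra "mv_power A T"
    by (rule mv_algebra_power)
  interpret cod: mv_algebra "mv_power A S"
    by (rule mv_algebra_power)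
  let ?I = "\<lambda>s. {t \<in> T. (s, t) \<in> R}"
  have G: "G p = (\<lambda>s\<in>S. mv_Inf (?I s) p)" if "p \<in> carrier (mv_power A T)" for p
    using G[OF that] by (simp add: G_star_eq_mv_Inf)
  have fam: "p \<in> ?I s \<rightarrow> carrier A" if "p \<in> carrier (mv_power A T)" for p s
    using that by auto
  \<comment> \<open>On a family indexed by successors, the restriction to \<open>T\<close> in the componentwise operations
    can be dropped.\<close>
  have res: "mv_Inf (?I s) (restrict h T) = mv_Inf (?I s) h" for h s
    by (rule mv_Inf_cong) simp
  have Gclosed: "G p \<in> carrier (mv_power A S)" if "p \<in> carrier (mv_power A T)" for p
    using that fam[OF that] by (simp add: G mv_Inf_closed)
  have Gmono: "G p \<sqsubseteq>\<^bsub>mv_order (mv_power A S)\<^esub> G q"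
    if p: "p \<in> carrier (mv_power A T)" and q: "q \<in> carrier (mv_power A T)"
      and "p \<sqsubseteq>\<^bsub>mv_order (mv_power A T)\<^esub> q" for p q
    unfolding G[OF p] G[OF q] mv_power_le_iff
  proof
    fix s assume "s \<in> S"
    have "mv_Inf (?I s) p \<preceq> q t" if "t \<in> ?I s" for t
      using that mv_Inf_lower[OF fam[OF p] that] p q \<open>p \<sqsubseteq>\<^bsub>mv_order (mv_power A T)\<^esub> q\<close>
        le_trans[OF mv_Inf_closed[OF fam[OF p, of s]], of "p t" "q t"]
      by (auto simp: mv_power_le_iff)
    then show "(\<lambda>s\<in>S. mv_Inf (?I s) p) s \<preceq> (\<lambda>s\<in>S. mv_Inf (?I s) q) s"
      using \<open>s \<in> S\<close> by (simp add: le_mv_Inf_iff[OF fam[OF q]] mv_Inf_closed[OF fam[OF p]])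
  qed
  have Gone: "G \<one>\<^bsub>mv_power A T\<^esub> = \<one>\<^bsub>mv_power A S\<^esub>"
    unfolding G[OF dom.one_closed] unfolding mv_power_ops res
    by (simp add: mv_Inf_one)
  have Gtimes: "G p \<odot>\<^bsub>mv_power A S\<^esub> G q \<sqsubseteq>\<^bsub>mv_order (mv_power A S)\<^esub> G (p \<odot>\<^bsub>mv_power A T\<^esub> q)"
    if p: "p \<in> carrier (mv_power A T)" and q: "q \<in> carrier (mv_power A T)" for p q
    unfolding G[OF p] G[OF q] G[OF dom.times_closed[OF p q]] unfolding mv_power_ops mv_power_le_iff res
    using star_mv_Inf_le[where star = "(\<odot>)", OF fam[OF p] fam[OF q] times_closed times_mono] by simp
  have Gplus: "G p \<oplus>\<^bsub>mv_power A S\<^esub> G q \<sqsubseteq>\<^bsub>mv_order (mv_power A S)\<^esub> G (p \<oplus>\<^bsub>mv_power A T\<^esub> q)"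
    if p: "p \<in> carrier (mv_power A T)" and q: "q \<in> carrier (mv_power A T)" for p q
    unfolding G[OF p] G[OF q] G[OF dom.plus_closed[OF p q]] unfolding mv_power_ops mv_power_le_iff res
    using star_mv_Inf_le[where star = "(\<oplus>)", OF fam[OF p] fam[OF q] plus_closed plus_mono] by simp
  have Gpow: "G (mv_pow (mv_power A T) p n) = mv_pow (mv_power A S) (G p) n"
    if p: "p \<in> carrier (mv_power A T)" for p n
    unfolding G[OF p] G[OF dom.mv_pow_closed[OF p]] unfolding mv_pow_power res
    by (rule restrict_ext) (simp add: mv_Inf_pow[OF fam[OF p]])
  have Gmultiple: "mv_multiple (mv_power A S) n (G p) = G (mv_multiple (mv_power A T) n p)"
    if p: "p \<in> carrier (mv_power A T)" and "n \<ge> 1" for p n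
    unfolding G[OF p] G[OF dom.mv_multiple_closed[OF p]] unfolding mv_multiple_power res
    by (rule restrict_ext) (simp add: mv_Inf_multiple[OF fam[OF p] \<open>n \<ge> 1\<close>])
  show ?thesis
  proof unfold_locales
    show "G \<in> carrier (mv_power A T) \<rightarrow> carrier (mv_power A S)"
      using Gclosed by blast
    fix p q assume p: "p \<in> carrier (mv_power A T)" and q: "q \<in> carrier (mv_power A T)"
    show "G (p \<odot>\<^bsub>mv_power A T\<^esub> q) = \<one>\<^bsub>mv_power A S\<^esub>"
      if "G p = \<one>\<^bsub>mv_power A S\<^esub>" "G q = \<one>\<^bsub>mv_power A S\<^esub>"
      using Gtimes[OF p q] that p q
      by (intro cod.le_antisym)
        (simp_all only: Gclosed dom.times_closed cod.one_closed cod.le_one cod.times_one)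
    show "G p \<sqinter>\<^bsub>mv_order (mv_power A S)\<^esub> G q = G (p \<sqinter>\<^bsub>mv_order (mv_power A T)\<^esub> q)"
    proof -
      have m: "(\<lambda>t\<in>T. p t \<sqinter>\<^bsub>mv_order A\<^esub> q t) \<in> carrier (mv_power A T)"
        using p q by (auto simp: meet_closed PiE_iff)
      have meets: "p \<sqinter>\<^bsub>mv_order (mv_power A T)\<^esub> q = (\<lambda>t\<in>T. p t \<sqinter>\<^bsub>mv_order A\<^esub> q t)"
        "G p \<sqinter>\<^bsub>mv_order (mv_power A S)\<^esub> G q = (\<lambda>s\<in>S. G p s \<sqinter>\<^bsub>mv_order A\<^esub> G q s)"
        using p q Gclosed by (auto intro!: meet_power)
      show ?thesis
        unfolding meets G[OF m] unfolding G[OF p] G[OF q] res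
        by (rule restrict_ext) (simp add: mv_Inf_meet[OF fam[OF p] fam[OF q]])
    qed
  next
    fix p assume p: "p \<in> carrier (mv_power A T)"
    \<comment> \<open>Squares and doubles are the case \<open>n = 2\<close> of powers and multiples.\<close>
    have "mv_pow (mv_power A T) p 2 = p \<odot>\<^bsub>mv_power A T\<^esub> p"
      "mv_pow (mv_power A S) (G p) 2 = G p \<odot>\<^bsub>mv_power A S\<^esub> G p"
      "mv_multiple (mv_power A T) 2 p = p \<oplus>\<^bsub>mv_power A T\<^esub> p"
      "mv_multiple (mv_power A S) 2 (G p) = G p \<oplus>\<^bsub>mv_power A S\<^esub> G p"
      using p Gclosed[OF p]
      by (simp_all only: numeral_2_eq_2 mv_pow.simps mv_multiple.simps
          dom.times_one cod.times_one dom.plus_zero cod.plus_zero)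
    then show "G p \<odot>\<^bsub>mv_power A S\<^esub> G p = G (p \<odot>\<^bsub>mv_power A T\<^esub> p)"
      "G p \<oplus>\<^bsub>mv_power A S\<^esub> G p = G (p \<oplus>\<^bsub>mv_power A T\<^esub> p)"
      using Gpow[OF p, of 2] Gmultiple[OF p, of 2] by simp_all
  qed (fact Gone Gmono Gtimes Gplus Gmultiple | rule Gpow, assumption)+
qed

lemma complete_mv_chain_op: "complete_mv_chain (mv_op A)"
proof -
  interpret op: mv_algebra "mv_op A"
    by (rule mv_algebra_op)
  interpret op: partial_order "mv_order (mv_op A)"
    by (rule op.partial_order_mv_order)
  interpret L: complete_lattice "mv_order A"
    by (rule complete)
  have "total_order (mv_order (mv_op A))"
    by (rule op.total_orderI) (use linear in \<open>auto simp: mv_order_op_le_iff\<close>)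
  moreover have "complete_lattice (mv_order (mv_op A))"
    by (intro complete_lattice.intro complete_lattice_axioms.intro op.partial_order_axioms)
      (use L.sup_exists L.inf_exists in \<open>auto simp: is_glb_op_iff is_lub_op_iff\<close>)
  ultimately show ?thesis
    by (simp add: complete_mv_chain_def complete_mv_chain_axioms_def op.mv_algebra_axioms)
qed

text \<open>Both \<open>P\<^sup>*(q) \<le> p\<close> and \<open>q \<le> G\<^sup>*(p)\<close> unfold to \<open>q(s) \<le> p(t)\<close> for all pairs \<open>sRt\<close>;
  they differ in the order of the two quantifiers.\<close>

lemma left_adjoint_G_star:
  "left_adjoint (mv_power A T) (mv_power A S) (G_star A S T R)
    (G_star (mv_op A) T S (R\<inverse>))"
proof -
  interpret op: complete_mv_chain "mv_op A"
    by (rule complete_mv_chain_op)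
  interpret G: strong_fm_function "mv_power A T" "mv_power A S" "G_star A S T R"
    by (rule strong_fm_function_mv_Inf) simp
  interpret P: strong_fm_function "mv_power (mv_op A) S" "mv_power (mv_op A) T"
    "G_star (mv_op A) T S (R\<inverse>)"
    by (rule op.strong_fm_function_mv_Inf) simp
  have galois: "G_star (mv_op A) T S (R\<inverse>) q \<sqsubseteq>\<^bsub>mv_order (mv_power A T)\<^esub> p \<longleftrightarrow>
      q \<sqsubseteq>\<^bsub>mv_order (mv_power A S)\<^esub> G_star A S T R p"
    if p: "p \<in> T \<rightarrow>\<^sub>E carrier A" and q: "q \<in> S \<rightarrow>\<^sub>E carrier A" for p q
  proof -
    have pq: "\<And>t. t \<in> T \<Longrightarrow> p t \<in> carrier A" "\<And>s. s \<in> S \<Longrightarrow> q s \<in> carrier A"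
      using p q by auto
    have "G_star (mv_op A) T S (R\<inverse>) q \<sqsubseteq>\<^bsub>mv_order (mv_power A T)\<^esub> p \<longleftrightarrow>
        (\<forall>t\<in>T. \<forall>s\<in>{s \<in> S. (t, s) \<in> R\<inverse>}. q s \<preceq> p t)"
    proof -
      have "op.mv_Inf {s \<in> S. (t, s) \<in> R\<inverse>} q \<preceq> p t \<longleftrightarrow>
          (\<forall>s\<in>{s \<in> S. (t, s) \<in> R\<inverse>}. q s \<preceq> p t)" if "t \<in> T" for t
      proof -
        have fam: "q \<in> {s \<in> S. (t, s) \<in> R\<inverse>} \<rightarrow> carrier (mv_op A)"
          using q by auto
        show ?thesis
          using op.le_mv_Inf_iff[OF fam, of "p t"] op.mv_Inf_closed[OF fam] that pq
          by (auto simp: mv_order_op_le_iff)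
      qed
      then show ?thesis
        by (simp add: op.G_star_eq_mv_Inf mv_power_le_iff)
    qed
    also have "\<dots> \<longleftrightarrow> (\<forall>s\<in>S. \<forall>t\<in>{t \<in> T. (s, t) \<in> R}. q s \<preceq> p t)"
      by blast
    also have "\<dots> \<longleftrightarrow> q \<sqsubseteq>\<^bsub>mv_order (mv_power A S)\<^esub> G_star A S T R p"
    proof -
      have "q s \<preceq> mv_Inf {t \<in> T. (s, t) \<in> R} p \<longleftrightarrow> (\<forall>t\<in>{t \<in> T. (s, t) \<in> R}. q s \<preceq> p t)"
        if "s \<in> S" for s
        using that pq by (intro le_mv_Inf_iff) auto
      then show ?thesis
        by (simp add: G_star_eq_mv_Inf mv_power_le_iff)
    qed
    finally show ?thesis .
  qed
  show ?thesis
    unfolding left_adjoint_def galois_connection_def connection_def galois_connection_axioms_def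
    using galois G.closed P.closed G.dom.partial_order_mv_order G.cod.partial_order_mv_order
    by simp
qed

end

text \<open>The value \<open>P q\<close> is the least \<open>p\<close> with \<open>q \<le> G p\<close>, hence determined by \<open>G\<close>.\<close>

lemma left_adjoint_unique:
  assumes "mv_algebra A" and P: "left_adjoint A B G P" and Q: "left_adjoint A B G Q"
    and q: "q \<in> carrier B"
  shows "P q = Q q"
proof -
  interpret A: mv_algebra A
    by fact
  have closed: "P q \<in> carrier A" "Q q \<in> carrier A"
    and P_iff: "\<And>p. p \<in> carrier A \<Longrightarrow> P q \<sqsubseteq>\<^bsub>mv_order A\<^esub> p \<longleftrightarrow> q \<sqsubseteq>\<^bsub>mv_order B\<^esub> G p"
    and Q_iff: "\<And>p. p \<in> carrier A \<Longrightarrow> Q q \<sqsubseteq>\<^bsub>mv_order A\<^esub> p \<longleftrightarrow> q \<sqsubseteq>\<^bsub>mv_order B\<^esub> G p"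
    using P Q q
    unfolding left_adjoint_def galois_connection_def connection_def galois_connection_axioms_def
    by auto
  then show ?thesis
    using A.le_antisym A.le_refl by blast
qed

theorem theorem2:
  fixes M :: "('a, 'm) mv_scheme"
    and S :: "'s set" and T :: "'t set" and R :: "('s \<times> 't) set"
  assumes "mv_algebra M"
    and "total_order (mv_order M)"
    and "complete_lattice (mv_order M)"
    and "frame S T R"
  shows "strong_fm_function (mv_power M T) (mv_power M S) (G_star M S T R) \<and>
    (\<exists>P. left_adjoint (mv_power M T) (mv_power M S) (G_star M S T R) P) \<and>
    (\<forall>P. left_adjoint (mv_power M T) (mv_power M S) (G_star M S T R) P \<longrightarrow>
      (\<forall>q \<in> carrier (mv_power M S). \<forall>t \<in> T.
        P q t = \<Squnion>\<^bsub>mv_order M\<^esub> {q s | s. s \<in> S \<and> (s, t) \<in> R}) \<and>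
      strong_fm_function (mv_op (mv_power M S)) (mv_op (mv_power M T)) P)"
proof -
  interpret complete_mv_chain M
    using assms by (simp add: complete_mv_chain_def complete_mv_chain_axioms_def)
  interpret op: complete_mv_chain "mv_op M"
    by (rule complete_mv_chain_op)
  let ?G = "G_star M S T R" and ?P = "G_star (mv_op M) T S (R\<inverse>)"
  have adjoint: "left_adjoint (mv_power M T) (mv_power M S) ?G ?P"
    by (rule left_adjoint_G_star)
  have P_eq: "P q = ?P q"
    if "left_adjoint (mv_power M T) (mv_power M S) ?G P" "q \<in> carrier (mv_power M S)" for P q
    using mv_algebra_power that(1) adjoint that(2) by (rule left_adjoint_unique)
  show ?thesis
  proof (intro conjI exI allI impI ballI)
    show "strong_fm_function (mv_power M T) (mv_power M S) ?G"
      by (rule strong_fm_function_mv_Inf) simp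
    show "left_adjoint (mv_power M T) (mv_power M S) ?G ?P"
      by (fact adjoint)
    fix P assume P: "left_adjoint (mv_power M T) (mv_power M S) ?G P"
    show "P q t = \<Squnion>\<^bsub>mv_order M\<^esub> {q s | s. s \<in> S \<and> (s, t) \<in> R}"
      if "q \<in> carrier (mv_power M S)" "t \<in> T" for q t
      using that by (simp add: P_eq[OF P] G_star_def Inf_op)
    show "strong_fm_function (mv_op (mv_power M S)) (mv_op (mv_power M T)) P"
      unfolding mv_op_power
      by (rule op.strong_fm_function_mv_Inf) (simp add: P_eq[OF P])
  qed
qed

end
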